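(* Let $\mathcal{X}$, $\mathcal{Y}$ be Polish spaces, $\gamma_0\in\mathcal{P}(\mathcal{Y})$, and let $\psi:\mathcal{P}(\mathcal{X})\times\mathcal{Y}\to\mathcal{X}$ be Borel measurable. For $\gamma\in\mathcal{P}(\mathcal{Y})$ and $\mu\in\mathcal{P}(\mathcal{X})$ let $\Psi_\gamma(\mu)=\gamma\circ\psi^{-1}(\mu,\cdot)$ be the image measure of $\gamma$ under $y\mapsto\psi(\mu,y)$. Assume that there is a Borel measurable set $\mathcal{D}\subset\mathcal{P}(\mathcal{Y})$ such that: (A1) for every $\gamma\in\mathcal{D}$ the equation $\mu=\Psi_\gamma(\mu)$ has a unique solution $\mu_\ast(\gamma)\in\mathcal{P}(\mathcal{X})$, and the mapping $\mathcal{D}\ni\gamma\mapsto\mu_\ast(\gamma)\in\mathcal{P}(\mathcal{X})$ is Borel measurable; (A2) for all $N\in\mathbb{N}$, $\otimes^N\gamma_0\bigl\{(y_1,\dots,y_N)\in\mathcal{Y}^N:\frac1N\sum_{i=1}^N\delta_{y_i}\in\mathcal{D}\bigr\}=1$; (A3) if $\gamma\in\mathcal{P}(\mathcal{Y})$ is such that $R(\gamma\|\gamma_0)<\infty$, then $\gamma\in\mathcal{D}$ and $\mu_{\ast|\mathcal{D}}$ is continuous at $\gamma$. Let $I:\mathcal{P}(\mathcal{X})\to[0,\infty]$ be given by $$I(\eta)=\inf_{\gamma\in\mathcal{D}:\,\mu_\ast(\gamma)=\eta}R(\gamma\|\gamma_0),\qquad\inf\varnothing=\infty.$$ Then for all $\eta\in\mathcal{P}(\mathcal{X})$,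 $$I(\eta)=R\bigl(\eta\,\|\,\Psi_{\gamma_0}(\eta)\bigr).$$
   Context: For a Polish space $\mathcal{S}$, $\mathcal{P}(\mathcal{S})$ is the space of probability measures on the Borel $\sigma$-algebra $\mathcal{B}(\mathcal{S})$ with the topology of weak convergence. The relative entropy is $R(\nu\|\mu)=\int_{\mathcal{S}}\log\bigl(\frac{d\nu}{d\mu}\bigr)d\nu$ if $\nu$ is absolutely continuous with respect to $\mu$, and $R(\nu\|\mu)=\infty$ otherwise. $\delta_x$ is the Dirac measure at $x$. The function $I$ is the large deviation rate function of the empirical measures $\mu^N$ of $\mathcal{X}$-valued random variables $X^N_1,\dots,X^N_N$ which satisfy $X^N_i=\psi(\mu^N,Y^N_i)$ almost surely, where $Y^N_1,\dots,Y^N_N$ are i.i.d. with common distribution $\gamma_0$. *)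

theory Defs
  imports "HOL-Probability.Probability"
begin

definition prob_measures :: "'a::topological_space measure set" where
  "prob_measures = {\<mu>. sets \<mu> = sets borel \<and> prob_space \<mu>}"

(* The coarsest topology on the probability measures for which every map
   \<mu> \<mapsto> \<integral>f d\<mu>, with f bounded and continuous, is continuous. *)
definition weak_topology :: "'a::topological_space measure topology" where
  "weak_topology = topology_generated_by
     {{\<mu> \<in> prob_measures. (\<integral>x. f x \<partial>\<mu>) \<in> U} | f U.
        continuous_on UNIV f \<and> bounded (range f) \<and> open (U :: real set)}"

lemma topspace_weak_topology [simp]: "topspace weak_topology = prob_measures"
proof -
  have "continuous_on UNIV (\<lambda>x::'a. 0::real) \<and> bounded (range (\<lambda>x::'a. 0::real)) \<and> open (UNIV::real set)"
    by auto
  moreover have "prob_measures = {\<mu> \<in> prob_measures. integral\<^sup>L \<mu> (\<lambda>x::'a. 0::real) \<in> UNIV}"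
    by simp
  ultimately show ?thesis
    unfolding weak_topology_def topology_generated_by_topspace by blast
qed

definition borel_of :: "'a topology \<Rightarrow> 'a measure" where
  "borel_of T = sigma (topspace T) {U. openin T U}"

(* \<integral>f d\<mu> as the difference of the integrals of the positive and negative parts
   (ennreal maps negative reals to 0); meaningful if one of the two is finite. *)
definition ext_integral :: "'a measure \<Rightarrow> ('a \<Rightarrow> real) \<Rightarrow> ereal" where
  "ext_integral \<mu> f =
     enn2ereal (\<integral>\<^sup>+x. ennreal (f x) \<partial>\<mu>) - enn2ereal (\<integral>\<^sup>+x. ennreal (- f x) \<partial>\<mu>)"

(* Unlike KL_divergence, which is real-valued and hence 0 when the integral
   diverges, this takes the value \<infinity>. For probability measures the negative part of
   log (d\<nu>/d\<mu>) is always \<nu>-integrable, and 0 < d\<nu>/d\<mu> < \<infinity> holds \<nu>-almost everywhere. *)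
definition rel_entropy :: "'a measure \<Rightarrow> 'a measure \<Rightarrow> ereal" where
  "rel_entropy \<nu> \<mu> =
     (if absolutely_continuous \<mu> \<nu>
      then ext_integral \<nu> (\<lambda>x. ln (enn2real (RN_deriv \<mu> \<nu> x)))
      else \<infinity>)"

definition empirical_measure :: "nat \<Rightarrow> (nat \<Rightarrow> 'b::topological_space) \<Rightarrow> 'b measure" where
  "empirical_measure N y =
     measure_of UNIV (sets borel) (\<lambda>A. (\<Sum>i<N. emeasure (return borel (y i)) A) / of_nat N)"

definition image_law ::
  "('a::topological_space measure \<Rightarrow> 'b \<Rightarrow> 'a) \<Rightarrow> 'b measure \<Rightarrow> 'a measure \<Rightarrow> 'a measure" where
  "image_law \<psi> \<gamma> \<mu> = distr \<gamma> borel (\<psi> \<mu>)"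

definition mu_star ::
  "('a::topological_space measure \<Rightarrow> 'b \<Rightarrow> 'a) \<Rightarrow> 'b measure \<Rightarrow> 'a measure" where
  "mu_star \<psi> \<gamma> = (THE \<mu>. \<mu> \<in> prob_measures \<and> \<mu> = image_law \<psi> \<gamma> \<mu>)"

(* The infimum is taken in ereal, so it is \<infinity> over the empty set. *)
definition rate_function ::
  "('a::topological_space measure \<Rightarrow> 'b \<Rightarrow> 'a) \<Rightarrow> 'b measure \<Rightarrow> 'b measure set \<Rightarrow> 'a measure \<Rightarrow> ereal" where
  "rate_function \<psi> \<gamma>\<^sub>0 D \<eta> = (INF \<gamma>\<in>{\<gamma>\<in>D. mu_star \<psi> \<gamma> = \<eta>}. rel_entropy \<gamma> \<gamma>\<^sub>0)"

end

theory Submission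
  imports Defs
begin

text \<open>
  Two observations prove the identity.

  The first one removes the fixed point equation. Let \<open>\<gamma>\<close> be a law with
  \<open>R(\<gamma> \<parallel> \<gamma>\<^sub>0) < \<infinity>\<close>. Then \<open>\<gamma>\<close> lies in \<open>D\<close>, and as the fixed point of
  \<open>\<mu> \<mapsto> \<Psi>\<^sub>\<gamma>(\<mu>)\<close> is unique, \<open>\<mu>\<^sub>*(\<gamma>) = \<eta>\<close> says exactly that \<open>\<eta>\<close> is the image of \<open>\<gamma>\<close>
  under \<open>f = \<psi>(\<eta>, \<cdot>)\<close>. Here \<open>\<eta>\<close> is fixed in the first argument of \<open>\<psi>\<close>, so \<open>f\<close> does not
  depend on \<open>\<gamma>\<close>, and \<open>I(\<eta>)\<close> is the infimum of \<open>R(\<gamma> \<parallel> \<gamma>\<^sub>0)\<close> over all \<open>\<gamma>\<close>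
  with \<open>\<gamma> \<circ> f\<^sup>-\<^sup>1 = \<eta>\<close>.

  The second one evaluates this infimum as \<open>R(\<eta> \<parallel> \<gamma>\<^sub>0 \<circ> f\<^sup>-\<^sup>1)\<close>. It cannot be smaller, because
  relative entropy does not increase under measurable maps (\<open>rel_entropy_distr_le\<close>). If that
  entropy is finite, the infimum is attained: a density \<open>h\<close> of \<open>\<eta>\<close> with respect to \<open>\<gamma>\<^sub>0 \<circ> f\<^sup>-\<^sup>1\<close> pulls back to the density
  \<open>h \<circ> f\<close> with respect to \<open>\<gamma>\<^sub>0\<close> of a law with the same entropy (\<open>rel_entropy_lift\<close>).
  Its entropy being finite, this law belongs to \<open>D\<close> and competes in the infimum.
\<close>

lemma ext_integral_distr:
  assumes [measurable]: "f \<in> M \<rightarrow>\<^sub>M N" "u \<in> borel_measurable N"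
  shows "ext_integral (distr M N f) u = ext_integral M (\<lambda>x. u (f x))"
  by (simp add: ext_integral_def nn_integral_distr)

lemma ext_integral_cong_AE:
  assumes "AE x in M. u x = v x"
  shows "ext_integral M u = ext_integral M v"
proof -
  have "(\<integral>\<^sup>+x. ennreal (u x) \<partial>M) = (\<integral>\<^sup>+x. ennreal (v x) \<partial>M)"
       "(\<integral>\<^sup>+x. ennreal (- u x) \<partial>M) = (\<integral>\<^sup>+x. ennreal (- v x) \<partial>M)"
    using assms by (auto intro!: nn_integral_cong_AE)
  then show ?thesis by (simp add: ext_integral_def)
qed

lemma rel_entropy_density:
  fixes g :: "'a \<Rightarrow> real"
  assumes "sigma_finite_measure M" and [measurable]: "g \<in> borel_measurable M"
    and nonneg: "\<And>x. 0 \<le> g x"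
  shows "rel_entropy (density M g) M = ext_integral (density M g) (\<lambda>x. ln (g x))"
proof -
  interpret sigma_finite_measure M by fact
  have ac: "absolutely_continuous M (density M g)"
    by (rule absolutely_continuousI_density) simp
  have "AE x in M. ennreal (g x) = RN_deriv M (density M g) x"
    by (rule RN_deriv_unique) auto
  then have "AE x in density M g. ennreal (g x) = RN_deriv M (density M g) x"
    by (rule absolutely_continuous_AE[OF _ ac, rotated]) simp
  then have "AE x in density M g. ln (enn2real (RN_deriv M (density M g) x)) = ln (g x)"
    by eventually_elim (metis enn2real_ennreal nonneg)
  with ac show ?thesis
    by (simp add: rel_entropy_def ext_integral_cong_AE)
qed

lemma obtain_real_density:
  assumes "prob_space M" "prob_space P" "absolutely_continuous M P" "sets P = sets M"
  obtains g :: "'a \<Rightarrow> real"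
    where "g \<in> borel_measurable M" "\<And>x. 0 \<le> g x" "P = density M g"
proof -
  interpret M: prob_space M by fact
  interpret P: prob_space P by fact
  obtain g where g: "g \<in> borel_measurable M" "AE x in M. RN_deriv M P x = ennreal (g x)"
      "\<And>x. 0 \<le> g x"
    by (rule M.real_RN_deriv[OF P.finite_measure_axioms assms(3,4)]) blast
  have "P = density M (RN_deriv M P)"
    using assms by (simp add: M.density_RN_deriv)
  also have "\<dots> = density M g"
    using g by (auto intro!: density_cong)
  finally show ?thesis using g that by blast
qed

text \<open>
  Integrate \<open>ln (k / g) \<le> k / g - 1\<close> with respect to the law with density \<open>g\<close>, under which
  \<open>k / g\<close> has integral at most \<open>\<integral>k dM \<le> 1\<close>. The inequality is rearranged so that all
  terms are nonnegative, because neither logarithm has to be integrable. Positivity of \<open>k\<close> is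
  assumed because HOL sets \<open>ln 0 = 0\<close>, where the inequality would need the value \<open>-\<infinity>\<close>.
\<close>

lemma gibbs_inequality:
  fixes g k :: "'a \<Rightarrow> real"
  assumes [measurable]: "g \<in> borel_measurable M" "k \<in> borel_measurable M"
    and "prob_space M" and G: "prob_space (density M g)"
    and nonneg: "\<And>x. 0 \<le> g x" "\<And>x. 0 \<le> k x"
    and k_le_1: "(\<integral>\<^sup>+x. k x \<partial>M) \<le> 1"
    and k_pos: "AE x in density M g. 0 < k x"
  shows "ext_integral (density M g) (\<lambda>x. ln (k x)) \<le> ext_integral (density M g) (\<lambda>x. ln (g x))"
proof -
  interpret M: prob_space M by fact
  let ?G = "density M g"
  interpret G: prob_space ?G by fact
  have ratio: "(\<integral>\<^sup>+x. ennreal (u x / g x) \<partial>?G) \<le> (\<integral>\<^sup>+x. ennreal (u x) \<partial>M)"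
    if [measurable]: "u \<in> borel_measurable M" and u: "\<And>x. 0 \<le> u x" for u :: "'a \<Rightarrow> real"
  proof -
    have "(\<integral>\<^sup>+x. ennreal (u x / g x) \<partial>?G) = (\<integral>\<^sup>+x. ennreal (g x) * ennreal (u x / g x) \<partial>M)"
      by (simp add: nn_integral_density)
    also have "\<dots> \<le> (\<integral>\<^sup>+x. ennreal (u x) \<partial>M)"
      by (rule nn_integral_mono) (use u nonneg in \<open>auto simp flip: ennreal_mult\<close>)
    finally show ?thesis .
  qed
  define Ap where "Ap = (\<integral>\<^sup>+x. ennreal (ln (g x)) \<partial>?G)"
  define Am where "Am = (\<integral>\<^sup>+x. ennreal (- ln (g x)) \<partial>?G)"
  define Bp where "Bp = (\<integral>\<^sup>+x. ennreal (ln (k x)) \<partial>?G)"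
  define Bm where "Bm = (\<integral>\<^sup>+x. ennreal (- ln (k x)) \<partial>?G)"
  define Q where "Q = (\<integral>\<^sup>+x. ennreal (k x / g x) \<partial>?G)"
  have Q: "Q \<le> 1"
    unfolding Q_def using ratio[of k] nonneg k_le_1 by (auto intro: order_trans)
  have pos: "AE x in ?G. 0 < g x \<and> 0 < k x"
    using k_pos by (auto simp: AE_density)
  have log_ratio: "ln b \<le> ln a + b / a - 1" if "0 < a" "0 < b" for a b :: real
    using ln_le_minus_one[of "b / a"] that by (simp add: ln_div)
  have "Am \<le> (\<integral>\<^sup>+x. ennreal (1 / g x) \<partial>?G)"
    unfolding Am_def
  proof (rule nn_integral_mono_AE, use pos in eventually_elim)
    case (elim x)
    then show ?case using log_ratio[of "g x" 1] by (intro ennreal_leI) auto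
  qed
  also have "\<dots> \<le> 1"
    using ratio[of "\<lambda>_. 1"] by (simp add: M.emeasure_space_1)
  finally have Am: "Am \<le> 1" .
  have "Bp \<le> (\<integral>\<^sup>+x. ennreal (ln (g x)) + ennreal (k x / g x) \<partial>?G)"
    unfolding Bp_def
  proof (rule nn_integral_mono_AE, use pos in eventually_elim)
    case (elim x)
    have "ennreal (ln (k x)) \<le> ennreal (max 0 (ln (g x)) + k x / g x)"
      using elim log_ratio[of "g x" "k x"] by (intro ennreal_leI) linarith
    then show ?case
      using elim by (simp add: ennreal_plus max_def split: if_splits) (simp add: ennreal_neg)
  qed
  then have Bp: "Bp \<le> Ap + Q"
    by (simp add: nn_integral_add Ap_def Q_def)
  have "(\<integral>\<^sup>+x. ennreal (ln (k x)) + ennreal (- ln (g x)) + 1 \<partial>?G)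
      \<le> (\<integral>\<^sup>+x. ennreal (ln (g x)) + ennreal (- ln (k x)) + ennreal (k x / g x) \<partial>?G)"
  proof (rule nn_integral_mono_AE, use pos in eventually_elim)
    case (elim x)
    have pp: "ennreal t = ennreal (max 0 t)" for t
      by (simp add: max_def ennreal_neg)
    have "ennreal (max 0 (ln (k x)) + max 0 (- ln (g x)) + 1)
        \<le> ennreal (max 0 (ln (g x)) + max 0 (- ln (k x)) + k x / g x)"
      using elim log_ratio[of "g x" "k x"] by (intro ennreal_leI) linarith
    then show ?case
      using elim by (subst (1 2 3 4) pp) (simp add: ennreal_plus del: max_0_1)
  qed
  then have main: "Bp + Am + 1 \<le> Ap + Bm + Q"
    by (simp add: nn_integral_add Ap_def Am_def Bp_def Bm_def Q_def G.emeasure_space_1[simplified])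
  \<comment> \<open>As \<open>Am\<close> is finite, the right-hand side is never \<open>\<infinity> - \<infinity>\<close>. If \<open>Ap\<close> is finite, so is \<open>Bp\<close>,
    and then only \<open>Bm\<close> can be infinite, which makes the left-hand side \<open>-\<infinity>\<close>.\<close>
  have "enn2ereal Bp - enn2ereal Bm \<le> enn2ereal Ap - enn2ereal Am"
  proof (cases "Ap = \<infinity>")
    case True
    with Am show ?thesis by (cases Am) (auto simp: top_unique)
  next
    case False
    have "Q \<noteq> \<infinity>" "Am \<noteq> \<infinity>" using Q Am by (auto simp: top_unique)
    moreover from this False Bp have "Bp \<noteq> \<infinity>" by (auto simp: top_unique)
    ultimately obtain q am bp ap where
        r: "Q = ennreal q" "Am = ennreal am" "Bp = ennreal bp" "Ap = ennreal ap"
        "0 \<le> q" "0 \<le> am" "0 \<le> bp" "0 \<le> ap"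
      using False by (metis ennreal_cases infinity_ennreal_def)
    show ?thesis
    proof (cases Bm)
      case (real bm)
      have "ennreal (bp + am + 1) \<le> ennreal (ap + bm + q)"
        using main r real by (simp add: ennreal_plus)
      moreover have "q \<le> 1" using Q r by simp
      ultimately have "bp + am \<le> ap + bm" using r real
        by (subst (asm) ennreal_le_iff) auto
      then show ?thesis using r real by (simp add: enn2ereal_ennreal)
    next
      case top
      then show ?thesis using r by (simp add: enn2ereal_ennreal)
    qed
  qed
  then show ?thesis
    by (simp add: ext_integral_def Ap_def Am_def Bp_def Bm_def)
qed

lemma absolutely_continuous_distr:
  assumes "absolutely_continuous M P" "sets P = sets M" and f: "f \<in> M \<rightarrow>\<^sub>M N"
  shows "absolutely_continuous (distr M N f) (distr P N f)"
  unfolding absolutely_continuous_def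
proof
  fix A assume "A \<in> null_sets (distr M N f)"
  then have "A \<in> sets N" "f -` A \<inter> space M \<in> null_sets M"
    using f by (auto simp: null_sets_def emeasure_distr intro: measurable_sets)
  moreover have "f \<in> P \<rightarrow>\<^sub>M N" using f assms(2) by (simp cong: measurable_cong_sets)
  ultimately show "A \<in> null_sets (distr P N f)"
    using assms(1) sets_eq_imp_space_eq[OF assms(2)]
    by (auto simp: null_sets_def emeasure_distr absolutely_continuous_def)
qed

text \<open>
  The data processing inequality. If \<open>g\<close> is the density of \<open>P\<close> and \<open>h\<close> that of its image,
  then \<open>h \<circ> f\<close> is a second probability density on the source space, and the entropy of the image is
  the integral of its logarithm under \<open>P\<close>. By Gibbs' inequality \<open>ln \<circ> g\<close> has the largest
  such integral.
\<close>

lemma rel_entropy_distr_le: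
  fixes f :: "'a \<Rightarrow> 'b"
  assumes M: "prob_space M" and P: "prob_space P" and [measurable_cong]: "sets P = sets M"
    and [measurable]: "f \<in> M \<rightarrow>\<^sub>M N"
  shows "rel_entropy (distr P N f) (distr M N f) \<le> rel_entropy P M"
proof (cases "absolutely_continuous M P")
  case False
  then show ?thesis by (simp add: rel_entropy_def)
next
  case ac: True
  let ?M' = "distr M N f" and ?P' = "distr P N f"
  interpret M: prob_space M by fact
  interpret P: prob_space P by fact
  interpret M': prob_space ?M' by (rule M.prob_space_distr) simp
  interpret P': prob_space ?P' by (rule P.prob_space_distr) simp
  obtain g :: "'a \<Rightarrow> real"
    where g: "g \<in> borel_measurable M" "\<And>x. 0 \<le> g x" "P = density M g"
    by (rule obtain_real_density[OF M P ac assms(3)]) blast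
  obtain h :: "'b \<Rightarrow> real"
    where h: "h \<in> borel_measurable ?M'" "\<And>x. 0 \<le> h x" "?P' = density ?M' h"
    by (rule obtain_real_density[OF M'.prob_space_axioms P'.prob_space_axioms
          absolutely_continuous_distr[OF ac assms(3,4)]]) auto
  have [measurable]: "h \<in> borel_measurable N" using h(1) by simp
  have "rel_entropy ?P' ?M' = ext_integral ?P' (\<lambda>y. ln (h y))"
    using rel_entropy_density[OF M'.sigma_finite_measure_axioms h(1,2)] h(3) by simp
  also have "\<dots> = ext_integral P (\<lambda>x. ln (h (f x)))"
    by (rule ext_integral_distr) measurable
  also have "\<dots> \<le> ext_integral P (\<lambda>x. ln (g x))"
    unfolding g(3)
  proof (rule gibbs_inequality[OF g(1) _ M _ g(2)])
    show "prob_space (density M g)" using P g(3) by simp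
    have "(\<integral>\<^sup>+x. ennreal (h (f x)) \<partial>M) = emeasure (density ?M' h) (space ?M')"
      by (simp add: emeasure_density nn_integral_distr cong: nn_integral_cong)
         (auto intro!: nn_integral_cong simp: measurable_space[OF assms(4)])
    also have "\<dots> = 1" using P'.emeasure_space_1 h(3) by simp
    finally show "(\<integral>\<^sup>+x. ennreal (h (f x)) \<partial>M) \<le> 1" by simp
    have "AE y in ?P'. 0 < h y"
      unfolding h(3) by (simp add: AE_density)
    then show "AE x in density M g. 0 < h (f x)"
      unfolding g(3)[symmetric] by (rule AE_distrD[rotated]) simp
  qed (use h in auto)
  also have "\<dots> = rel_entropy P M"
    using rel_entropy_density[OF M.sigma_finite_measure_axioms g(1,2)] g(3) by simp
  finally show ?thesis .
qed

text \<open>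
  Equality in the data processing inequality: the density of the lifted law depends on \<open>x\<close> only
  through \<open>f x\<close>, so its logarithm has the same integral under the lift as the logarithm of the
  density of \<open>Q\<close> has under \<open>Q\<close>.
\<close>

lemma rel_entropy_lift:
  fixes f :: "'a \<Rightarrow> 'b"
  assumes M: "prob_space M" and Q: "prob_space Q" and sets_Q: "sets Q = sets N"
    and [measurable]: "f \<in> M \<rightarrow>\<^sub>M N" and ac: "absolutely_continuous (distr M N f) Q"
  obtains P where "prob_space P" "sets P = sets M" "distr P N f = Q"
    "rel_entropy P M = rel_entropy Q (distr M N f)"
proof -
  let ?M' = "distr M N f"
  interpret M: prob_space M by fact
  interpret M': prob_space ?M' by (rule M.prob_space_distr) simp
  obtain h :: "'b \<Rightarrow> real"
    where h: "h \<in> borel_measurable ?M'" "\<And>y. 0 \<le> h y" "Q = density ?M' h"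
    by (rule obtain_real_density[OF M'.prob_space_axioms Q ac]) (use sets_Q in auto)
  have [measurable]: "h \<in> borel_measurable N" using h(1) by simp
  define P where "P = density M (\<lambda>x. ennreal (h (f x)))"
  have [measurable_cong]: "sets P = sets M" by (simp add: P_def)
  have distr_P: "distr P N f = Q"
    unfolding P_def h(3) by (rule density_distr[symmetric]) measurable
  have "prob_space P"
    by (rule prob_space_distrD[of f P N]) (use Q distr_P in auto)
  moreover have "rel_entropy P M = rel_entropy Q ?M'"
  proof -
    have "rel_entropy P M = ext_integral P (\<lambda>x. ln (h (f x)))"
      unfolding P_def using h(2)
      by (intro rel_entropy_density[OF M.sigma_finite_measure_axioms]) auto
    also have "\<dots> = ext_integral (distr P N f) (\<lambda>y. ln (h y))"
      by (rule ext_integral_distr[symmetric]) measurable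
    also have "\<dots> = rel_entropy Q ?M'"
      unfolding distr_P
      using rel_entropy_density[OF M'.sigma_finite_measure_axioms h(1,2)] h(3) by simp
    finally show ?thesis .
  qed
  ultimately show ?thesis
    using that distr_P \<open>sets P = sets M\<close> by blast
qed

lemma continuous_map_measurable_borel_of:
  fixes T :: "'b topology"
  assumes "continuous_map euclidean T f"
  shows "f \<in> borel \<rightarrow>\<^sub>M borel_of T"
  unfolding borel_of_def
proof (rule measurable_measure_of)
  show "{U. openin T U} \<subseteq> Pow (topspace T)" by (auto dest: openin_subset)
  show "f \<in> space borel \<rightarrow> topspace T"
    using continuous_map_funspace[OF assms] by simp
  show "f -` U \<inter> space borel \<in> sets borel" if "U \<in> {U. openin T U}" for U
    using openin_continuous_map_preimage[OF assms, of U] that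
    by (simp add: vimage_def)
qed

theorem corollary4p2:
  fixes \<gamma>\<^sub>0 :: "'b::polish_space measure"
    and \<psi> :: "'a::polish_space measure \<Rightarrow> 'b \<Rightarrow> 'a"
    and D :: "'b measure set"
    and \<eta> :: "'a measure"
  assumes gamma0: "\<gamma>\<^sub>0 \<in> prob_measures"
    and psi_measurable:
      "(\<lambda>(\<mu>, y). \<psi> \<mu> y) \<in> borel_of (prod_topology weak_topology euclidean) \<rightarrow>\<^sub>M borel"
    and D_borel: "D \<in> sets (borel_of weak_topology)"
    and A1_unique: "\<And>\<gamma>. \<gamma> \<in> D \<Longrightarrow> \<exists>!\<mu>. \<mu> \<in> prob_measures \<and> \<mu> = image_law \<psi> \<gamma> \<mu>"
    and A1_measurable:
      "mu_star \<psi> \<in> restrict_space (borel_of weak_topology) D \<rightarrow>\<^sub>M borel_of weak_topology"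
    and A2: "\<And>N::nat. N \<ge> 1 \<Longrightarrow>
      emeasure (\<Pi>\<^sub>M i\<in>{..<N}. \<gamma>\<^sub>0)
        {y \<in> space (\<Pi>\<^sub>M i\<in>{..<N}. \<gamma>\<^sub>0). empirical_measure N y \<in> D} = 1"
    and A3: "\<And>\<gamma>. \<gamma> \<in> prob_measures \<Longrightarrow> rel_entropy \<gamma> \<gamma>\<^sub>0 < \<infinity> \<Longrightarrow>
      \<gamma> \<in> D \<and> topcontinuous_at (subtopology weak_topology D) weak_topology (mu_star \<psi>) \<gamma>"
    and eta: "\<eta> \<in> prob_measures"
  shows "rate_function \<psi> \<gamma>\<^sub>0 D \<eta> = rel_entropy \<eta> (image_law \<psi> \<gamma>\<^sub>0 \<eta>)"
proof -
  define f where "f = \<psi> \<eta>"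
  define \<eta>\<^sub>0 where "\<eta>\<^sub>0 = distr \<gamma>\<^sub>0 borel f"
  have \<gamma>\<^sub>0: "prob_space \<gamma>\<^sub>0" "sets \<gamma>\<^sub>0 = sets borel" using gamma0 by (auto simp: prob_measures_def)
  have \<eta>: "prob_space \<eta>" "sets \<eta> = sets borel" using eta by (auto simp: prob_measures_def)
  \<comment> \<open>Joint measurability of \<open>\<psi>\<close> refers to the Borel sets of the product topology, so its section
    is measurable because \<open>y \<mapsto> (\<eta>, y)\<close> is continuous.\<close>
  have "(\<lambda>y. (\<eta>, y)) \<in> borel \<rightarrow>\<^sub>M borel_of (prod_topology weak_topology euclidean)"
    using eta by (intro continuous_map_measurable_borel_of) (simp add: continuous_map_pairedI)
  from measurable_comp[OF this psi_measurable] have "f \<in> borel \<rightarrow>\<^sub>M borel"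
    by (simp add: f_def comp_def)
  then have f: "f \<in> \<gamma>\<^sub>0 \<rightarrow>\<^sub>M borel"
    by (simp add: measurable_cong_sets[OF \<gamma>\<^sub>0(2) refl])
  have D_prob: "D \<subseteq> prob_measures"
    using sets.sets_into_space[OF D_borel]
    by (simp add: borel_of_def space_measure_of_conv)
  have mu_star_iff: "mu_star \<psi> \<gamma> = \<eta> \<longleftrightarrow> distr \<gamma> borel f = \<eta>" if "\<gamma> \<in> D" for \<gamma>
  proof
    assume "mu_star \<psi> \<gamma> = \<eta>"
    then show "distr \<gamma> borel f = \<eta>"
      using theI'[OF A1_unique[OF that]] by (simp add: mu_star_def image_law_def f_def)
  next
    assume "distr \<gamma> borel f = \<eta>"
    then show "mu_star \<psi> \<gamma> = \<eta>"
      unfolding mu_star_def using eta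
      by (intro the1_equality A1_unique that) (simp add: image_law_def f_def)
  qed
  have "rate_function \<psi> \<gamma>\<^sub>0 D \<eta> = rel_entropy \<eta> \<eta>\<^sub>0"
  proof (rule antisym)
    show "rel_entropy \<eta> \<eta>\<^sub>0 \<le> rate_function \<psi> \<gamma>\<^sub>0 D \<eta>"
      unfolding rate_function_def
    proof (rule INF_greatest)
      fix \<gamma> assume "\<gamma> \<in> {\<gamma> \<in> D. mu_star \<psi> \<gamma> = \<eta>}"
      then have "\<gamma> \<in> prob_measures" and \<gamma>: "distr \<gamma> borel f = \<eta>"
        using D_prob mu_star_iff by auto
      then have "prob_space \<gamma>" "sets \<gamma> = sets \<gamma>\<^sub>0"
        using \<gamma>\<^sub>0 by (auto simp: prob_measures_def)
      from rel_entropy_distr_le[OF \<gamma>\<^sub>0(1) this f] show "rel_entropy \<eta> \<eta>\<^sub>0 \<le> rel_entropy \<gamma> \<gamma>\<^sub>0"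
        by (simp add: \<gamma> \<eta>\<^sub>0_def)
    qed
    show "rate_function \<psi> \<gamma>\<^sub>0 D \<eta> \<le> rel_entropy \<eta> \<eta>\<^sub>0"
    proof (cases "rel_entropy \<eta> \<eta>\<^sub>0 < \<infinity>")
      case False
      then show ?thesis by simp
    next
      case True
      then have "absolutely_continuous \<eta>\<^sub>0 \<eta>"
        by (auto simp: rel_entropy_def split: if_splits)
      then obtain \<gamma> where \<gamma>: "prob_space \<gamma>" "sets \<gamma> = sets \<gamma>\<^sub>0" "distr \<gamma> borel f = \<eta>"
          "rel_entropy \<gamma> \<gamma>\<^sub>0 = rel_entropy \<eta> \<eta>\<^sub>0"
        unfolding \<eta>\<^sub>0_def by (rule rel_entropy_lift[OF \<gamma>\<^sub>0(1) \<eta> f])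
      have "\<gamma> \<in> prob_measures" using \<gamma> \<gamma>\<^sub>0 by (simp add: prob_measures_def)
      then have "\<gamma> \<in> D" using A3 \<gamma>(4) True by auto
      then have "\<gamma> \<in> {\<gamma> \<in> D. mu_star \<psi> \<gamma> = \<eta>}" using mu_star_iff \<gamma>(3) by simp
      then show ?thesis
        unfolding rate_function_def \<gamma>(4)[symmetric] by (rule INF_lower)
    qed
  qed
  then show ?thesis by (simp add: \<eta>\<^sub>0_def f_def image_law_def)
qed

end
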